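(* Let $\mathcal V$ be a complex topological vector space and $\mathcal D\subseteq\mathcal V_{\rm nc}$ a noncommutative set such that (P2) $UaU^*\in\mathcal D_n$ for all $a\in\mathcal D_n$ and unitary $U\in\mathbb C^{n\times n}$, and (P3) if $\begin{bmatrix}a&0\\0&c\end{bmatrix}\in\mathcal D_{n+m}$ with $a\in\mathcal V^{n\times n},c\in\mathcal V^{m\times m}$, then $a\in\mathcal D_n,c\in\mathcal D_m$. The following statements are equivalent: (i) for all $n,m\in\mathbb N$, $a\in\mathcal D_n$, $c\in\mathcal D_m$, $b\in\mathcal V^{n\times m}$: $\delta_{\mathcal D}(a,c)(b)=0\implies b=0$; (ii) for all $n\in\mathbb N$, $a\in\mathcal D_n$, $b\in\mathcal V^{n\times n}$: $\delta_{\mathcal D}(a,a)(b)=0\implies b=0$; (iii) for all $n\in\mathbb N$, $a,c\in\mathcal D_n$: $\tilde\delta_{\mathcal D}(a,c)=0\implies a=c$; (iv) for every $k\in\mathbb N$ there exists no non-constant noncommutative function $f\colon\mathbb C_{\rm nc}\to(\mathcal D_k)_{\rm nc}$.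
   Context: A noncommutative set is a family $\mathcal D=(\mathcal D_n)$, $\mathcal D_n\subseteq\mathcal V^{n\times n}$, closed under direct sums. For $a\in\mathcal D_n,c\in\mathcal D_m,b\in\mathcal V^{n\times m}$, $\delta_{\mathcal D}(a,c)(b)=\big[\sup\{t\in[0,+\infty]\colon\begin{bmatrix}a&sb\\0&c\end{bmatrix}\in\mathcal D_{n+m}\ \forall s\in[0,t]\}\big]^{-1}\in[0,+\infty]$ ($1/0=+\infty$, $1/\infty=0$), and $\tilde\delta_{\mathcal D}(a,c)=\delta_{\mathcal D}(a,c)(a-c)$ for $a,c\in\mathcal D_n$. $\mathbb C_{\rm nc}=\coprod_p\mathbb C^{p\times p}$, and $(\mathcal D_k)_{\rm nc}$ denotes the nc set over the vector space $\mathcal V^{k\times k}$ whose $p$-th level is $\mathcal D_{kp}$ (identifying $(\mathcal V^{k\times k})^{p\times p}$ with $\mathcal V^{kp\times kp}$). A noncommutative function $f$ between nc sets maps level $p$ to level $p$, respects direct sums and satisfies $f(T^{-1}ZT)=T^{-1}f(Z)T$ for invertible scalar $T$ (acting blockwise). *)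

theory Defs
  imports "HOL-Analysis.Analysis"
begin

text \<open>Matrices of size n x m over a type are represented as functions
  nat => nat => 'a that vanish outside the index range {0..<n} x {0..<m}.\<close>

definition vmat :: "nat \<Rightarrow> nat \<Rightarrow> (nat \<Rightarrow> nat \<Rightarrow> 'a::zero) set" where
  "vmat n m = {M. \<forall>i j. (n \<le> i \<or> m \<le> j) \<longrightarrow> M i j = 0}"

definition blk :: "nat \<Rightarrow> nat \<Rightarrow> (nat \<Rightarrow> nat \<Rightarrow> 'a) \<Rightarrow> (nat \<Rightarrow> nat \<Rightarrow> 'a)
    \<Rightarrow> (nat \<Rightarrow> nat \<Rightarrow> 'a) \<Rightarrow> (nat \<Rightarrow> nat \<Rightarrow> 'a::zero)" where
  "blk n m a b c = (\<lambda>i j.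
     if i < n then (if j < n then a i j else if j < n + m then b i (j - n) else 0)
     else if i < n + m \<and> n \<le> j \<and> j < n + m then c (i - n) (j - n) else 0)"

definition dsum :: "nat \<Rightarrow> nat \<Rightarrow> (nat \<Rightarrow> nat \<Rightarrow> 'a)
    \<Rightarrow> (nat \<Rightarrow> nat \<Rightarrow> 'a::zero) \<Rightarrow> (nat \<Rightarrow> nat \<Rightarrow> 'a)" where
  "dsum n m a c = blk n m a (\<lambda>_ _. 0) c"

definition nc_set :: "(nat \<Rightarrow> (nat \<Rightarrow> nat \<Rightarrow> 'a::zero) set) \<Rightarrow> bool" where
  "nc_set D \<longleftrightarrow> (\<forall>n\<ge>1. D n \<subseteq> vmat n n) \<and>
     (\<forall>n m a c. 1 \<le> n \<longrightarrow> 1 \<le> m \<longrightarrow> a \<in> D n \<longrightarrow> c \<in> D m \<longrightarrow> dsum n m a c \<in> D (n + m))"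

text \<open>A complex vector space is encoded as a real vector space 'a together with a
  complex structure J (real-linear, J o J = -id); complex scalars act by
  z . v = Re z v + Im z (J v).\<close>
definition cscale :: "('a::real_vector \<Rightarrow> 'a) \<Rightarrow> complex \<Rightarrow> 'a \<Rightarrow> 'a" where
  "cscale J z v = Re z *\<^sub>R v + Im z *\<^sub>R J v"

definition complex_structure :: "('a::real_vector \<Rightarrow> 'a) \<Rightarrow> bool" where
  "complex_structure J \<longleftrightarrow> linear J \<and> (\<forall>v. J (J v) = - v)"

text \<open>Blockwise action of scalar p x p matrices on kp x kp matrices over V
  (identified with p x p matrices over V^(k x k)):
  bleft k p S X = (S tensor I_k) X,  bright k p T X = X (T tensor I_k).
  For k = 1 these are the ordinary products.\<close>
definition bleft :: "('a \<Rightarrow> 'a) \<Rightarrow> nat \<Rightarrow> nat \<Rightarrow> (nat \<Rightarrow> nat \<Rightarrow> complex) \<Rightarrow> (nat \<Rightarrow> nat \<Rightarrow> 'a)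
    \<Rightarrow> (nat \<Rightarrow> nat \<Rightarrow> 'a::real_vector)" where
  "bleft J k p S X = (\<lambda>r s. if r < k * p \<and> s < k * p
      then (\<Sum>i'<p. cscale J (S (r div k) i') (X (k * i' + r mod k) s)) else 0)"

definition bright :: "('a \<Rightarrow> 'a) \<Rightarrow> nat \<Rightarrow> nat \<Rightarrow> (nat \<Rightarrow> nat \<Rightarrow> complex) \<Rightarrow> (nat \<Rightarrow> nat \<Rightarrow> 'a)
    \<Rightarrow> (nat \<Rightarrow> nat \<Rightarrow> 'a::real_vector)" where
  "bright J k p T X = (\<lambda>r s. if r < k * p \<and> s < k * p
      then (\<Sum>j'<p. cscale J (T j' (s div k)) (X r (k * j' + s mod k))) else 0)"

definition cmul :: "nat \<Rightarrow> (nat \<Rightarrow> nat \<Rightarrow> complex) \<Rightarrow> (nat \<Rightarrow> nat \<Rightarrow> complex)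
    \<Rightarrow> (nat \<Rightarrow> nat \<Rightarrow> complex)" where
  "cmul n S T = (\<lambda>i j. if i < n \<and> j < n then (\<Sum>l<n. S i l * T l j) else 0)"

definition idm :: "nat \<Rightarrow> (nat \<Rightarrow> nat \<Rightarrow> complex)" where
  "idm n = (\<lambda>i j. if i = j \<and> i < n then 1 else 0)"

definition adj :: "nat \<Rightarrow> (nat \<Rightarrow> nat \<Rightarrow> complex) \<Rightarrow> (nat \<Rightarrow> nat \<Rightarrow> complex)" where
  "adj n U = (\<lambda>i j. if i < n \<and> j < n then cnj (U j i) else 0)"

definition unitary_mat :: "nat \<Rightarrow> (nat \<Rightarrow> nat \<Rightarrow> complex) \<Rightarrow> bool" where
  "unitary_mat n U \<longleftrightarrow> U \<in> vmat n n \<and>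
     cmul n U (adj n U) = idm n \<and> cmul n (adj n U) U = idm n"

definition delta :: "(nat \<Rightarrow> (nat \<Rightarrow> nat \<Rightarrow> 'a::real_vector) set) \<Rightarrow> nat \<Rightarrow> nat
    \<Rightarrow> (nat \<Rightarrow> nat \<Rightarrow> 'a) \<Rightarrow> (nat \<Rightarrow> nat \<Rightarrow> 'a) \<Rightarrow> (nat \<Rightarrow> nat \<Rightarrow> 'a) \<Rightarrow> ennreal" where
  "delta D n m a c b =
     (let S = Sup {t::ennreal. \<forall>s::real. 0 \<le> s \<longrightarrow> ennreal s \<le> t \<longrightarrow>
                 blk n m a (\<lambda>i j. s *\<^sub>R b i j) c \<in> D (n + m)}
      in if S = 0 then top else if S = top then 0 else inverse S)"

definition delta_t :: "(nat \<Rightarrow> (nat \<Rightarrow> nat \<Rightarrow> 'a::real_vector) set) \<Rightarrow> nat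
    \<Rightarrow> (nat \<Rightarrow> nat \<Rightarrow> 'a) \<Rightarrow> (nat \<Rightarrow> nat \<Rightarrow> 'a) \<Rightarrow> ennreal" where
  "delta_t D n a c = delta D n n a c (\<lambda>i j. a i j - c i j)"

text \<open>Noncommutative function f from C_nc to (D_k)_nc: level p (p x p complex
  matrices) goes to D (k*p), identified with p x p matrices over V^(k x k).\<close>
definition nc_fun :: "('a \<Rightarrow> 'a) \<Rightarrow> (nat \<Rightarrow> (nat \<Rightarrow> nat \<Rightarrow> 'a::real_vector) set) \<Rightarrow> nat
    \<Rightarrow> (nat \<Rightarrow> (nat \<Rightarrow> nat \<Rightarrow> complex) \<Rightarrow> (nat \<Rightarrow> nat \<Rightarrow> 'a)) \<Rightarrow> bool" where
  "nc_fun J D k f \<longleftrightarrow>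
     (\<forall>p\<ge>1. \<forall>Z\<in>vmat p p. f p Z \<in> D (k * p)) \<and>
     (\<forall>p q Z W. 1 \<le> p \<longrightarrow> 1 \<le> q \<longrightarrow> Z \<in> vmat p p \<longrightarrow> W \<in> vmat q q \<longrightarrow>
        f (p + q) (dsum p q Z W) = dsum (k * p) (k * q) (f p Z) (f q W)) \<and>
     (\<forall>p Z S T. 1 \<le> p \<longrightarrow> Z \<in> vmat p p \<longrightarrow> S \<in> vmat p p \<longrightarrow> T \<in> vmat p p \<longrightarrow>
        cmul p S T = idm p \<longrightarrow> cmul p T S = idm p \<longrightarrow>
        f p (cmul p S (cmul p Z T)) = bright J k p T (bleft J k p S (f p Z)))"

definition nc_constant :: "(nat \<Rightarrow> (nat \<Rightarrow> nat \<Rightarrow> complex) \<Rightarrow> (nat \<Rightarrow> nat \<Rightarrow> 'a::zero)) \<Rightarrow> bool" where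
  "nc_constant f \<longleftrightarrow> (\<forall>p\<ge>1. \<forall>Z\<in>vmat p p. \<forall>W\<in>vmat p p. f p Z = f p W)"

end

theory Submission
  imports Defs
begin

text \<open>
  The condition \<open>\<delta>(a,c)(b) = 0\<close> says that the block matrix with diagonal \<open>a, c\<close> and corner \<open>s b\<close>
  lies in \<open>\<D>\<close> for all \<open>s \<ge> 0\<close>. Put \<open>A = a \<oplus> c\<close> and let \<open>B\<close> have the single nonzero block \<open>b\<close> in the
  upper right corner. Then the linear pencil \<open>F(Z) = I \<otimes> A + Z \<otimes> B\<close> lies in \<open>\<D>\<close> for every complex
  square matrix \<open>Z\<close>: by a singular value decomposition and unitary invariance one may take \<open>Z\<close>
  diagonal, where \<open>F(Z)\<close> is a direct sum of the given block matrices. Now \<open>F\<close> is itself an nc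
  function, nonconstant unless \<open>b = 0\<close>, so (iv) implies (i); evaluating \<open>F\<close> at the matrices with
  rows \<open>(0,s), (0,0)\<close> and \<open>(1,s), (0,0)\<close> gives \<open>\<delta>(A,A)(B) = 0\<close> and \<open>\<delta>(A+B,A)(B) = 0\<close>, so (ii) and
  (iii) imply (i). Conversely, conjugating \<open>Z \<oplus> W\<close> by a unipotent matrix shows that the values
  \<open>f(Z), f(W)\<close> of an nc function on all complex matrices have distance \<open>0\<close>, so (iii) implies (iv).
\<close>

section \<open>Matrix products, adjoints and unitary matrices\<close>

lemma cmul_apply: "i < p \<Longrightarrow> j < p \<Longrightarrow> cmul p S T i j = (\<Sum>l<p. S i l * T l j)"
  by (simp add: cmul_def)

lemma cmul_vmat: "cmul p S T \<in> vmat p p"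
  by (auto simp: cmul_def vmat_def)

lemma adj_vmat: "adj p S \<in> vmat p p"
  by (auto simp: adj_def vmat_def)

lemma vmat_eqI:
  assumes "X \<in> vmat n m" "Y \<in> vmat n m" "\<And>i j. i < n \<Longrightarrow> j < m \<Longrightarrow> X i j = Y i j"
  shows "X = Y"
proof (intro ext)
  fix i j
  show "X i j = Y i j"
    using assms by (cases "i < n \<and> j < m") (auto simp: vmat_def not_less)
qed

lemma cmul_assoc: "cmul p (cmul p S T) R = cmul p S (cmul p T R)"
proof (rule vmat_eqI[OF cmul_vmat cmul_vmat])
  fix i j assume ij: "i < p" "j < p"
  have "(\<Sum>l<p. (\<Sum>h<p. S i h * T h l) * R l j) = (\<Sum>l<p. \<Sum>h<p. S i h * T h l * R l j)"
    by (simp add: sum_distrib_right)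
  also have "\<dots> = (\<Sum>h<p. \<Sum>l<p. S i h * T h l * R l j)"
    by (rule sum.swap)
  finally show "cmul p (cmul p S T) R i j = cmul p S (cmul p T R) i j"
    using ij by (simp add: cmul_apply sum_distrib_left mult.assoc)
qed

lemma idm_vmat: "idm p \<in> vmat p p"
  by (auto simp: idm_def vmat_def)

lemma cmul_idm_left: "S \<in> vmat p p \<Longrightarrow> cmul p (idm p) S = S"
  by (rule vmat_eqI[OF cmul_vmat]) (auto simp: cmul_apply idm_def if_distrib[of "\<lambda>x. x * _"] cong: if_cong)

lemma adj_cmul: "adj p (cmul p S T) = cmul p (adj p T) (adj p S)"
  by (rule vmat_eqI[OF adj_vmat cmul_vmat]) (auto simp: adj_def cmul_apply mult.commute)

lemma adj_adj: "S \<in> vmat p p \<Longrightarrow> adj p (adj p S) = S"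
  by (rule vmat_eqI[OF adj_vmat]) (auto simp: adj_def)

lemma unitary_mat_adj: "unitary_mat p U \<Longrightarrow> unitary_mat p (adj p U)"
  by (simp add: unitary_mat_def adj_vmat adj_adj)

lemma unitary_mat_cmul:
  assumes U: "unitary_mat p U" and V: "unitary_mat p V"
  shows "unitary_mat p (cmul p U V)"
proof -
  have "cmul p (cmul p U V) (cmul p (adj p V) (adj p U)) = cmul p U (cmul p (cmul p V (adj p V)) (adj p U))"
    by (simp add: cmul_assoc)
  moreover have "cmul p (cmul p (adj p V) (adj p U)) (cmul p U V) = cmul p (adj p V) (cmul p (cmul p (adj p U) U) V)"
    by (simp add: cmul_assoc)
  ultimately show ?thesis
    using U V by (simp add: unitary_mat_def cmul_vmat adj_cmul cmul_idm_left adj_vmat)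
qed

lemma unitary_mat_idm: "unitary_mat p (idm p)"
proof -
  have "adj p (idm p) = idm p"
    by (auto simp: adj_def idm_def fun_eq_iff)
  then show ?thesis
    by (simp add: unitary_mat_def idm_vmat cmul_idm_left)
qed

lemma unitary_mat_rows:
  assumes "unitary_mat p U" "i < p" "j < p"
  shows "(\<Sum>l<p. U i l * cnj (U j l)) = (if i = j then 1 else 0)"
proof -
  have "cmul p U (adj p U) i j = idm p i j"
    using assms by (simp add: unitary_mat_def)
  then show ?thesis
    using assms by (simp add: cmul_apply adj_def idm_def)
qed

lemma unitary_mat_cols:
  assumes "unitary_mat p U" "i < p" "j < p"
  shows "(\<Sum>l<p. cnj (U l i) * U l j) = (if i = j then 1 else 0)"
proof -
  have "cmul p (adj p U) U i j = idm p i j"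
    using assms by (simp add: unitary_mat_def)
  then show ?thesis
    using assms by (simp add: cmul_apply adj_def idm_def)
qed

lemma unitary_matI:
  assumes "U \<in> vmat p p"
    and "\<And>i j. i < p \<Longrightarrow> j < p \<Longrightarrow> (\<Sum>l<p. U i l * cnj (U j l)) = (if i = j then 1 else 0)"
    and "\<And>i j. i < p \<Longrightarrow> j < p \<Longrightarrow> (\<Sum>l<p. cnj (U l i) * U l j) = (if i = j then 1 else 0)"
  shows "unitary_mat p U"
  unfolding unitary_mat_def
  by (intro conjI assms vmat_eqI[OF cmul_vmat idm_vmat])
    (simp_all add: cmul_apply adj_def idm_def assms)

text \<open>The rows of a unitary matrix have Euclidean norm 1. The bound puts all unitary matrices
  into one product of closed discs.\<close>

lemma unitary_mat_entry_le:
  assumes "unitary_mat p U"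
  shows "cmod (U i j) \<le> 1"
proof (cases "i < p \<and> j < p")
  case True
  have "(\<Sum>l<p. (cmod (U i l))\<^sup>2) = Re (\<Sum>l<p. U i l * cnj (U i l))"
    by (simp add: complex_mult_cnj cmod_power2)
  also have "\<dots> = 1"
    using unitary_mat_rows[OF assms, of i i] True by simp
  finally have "(\<Sum>l<p. (cmod (U i l))\<^sup>2) = 1" .
  moreover have "(cmod (U i j))\<^sup>2 \<le> (\<Sum>l<p. (cmod (U i l))\<^sup>2)"
    using True by (intro member_le_sum) auto
  ultimately have "(cmod (U i j))\<^sup>2 \<le> 1\<^sup>2" by simp
  then show ?thesis
    by (rule power2_le_imp_le) simp
next
  case False
  then show ?thesis
    using assms by (auto simp: unitary_mat_def vmat_def not_less)
qed

lemma continuous_on_entry: "continuous_on A (\<lambda>U::nat \<Rightarrow> nat \<Rightarrow> complex. U i j)"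
  by (rule continuous_on_product_then_coordinatewise[where f = "\<lambda>U. U i"],
      rule continuous_on_subset[OF continuous_on_product_coordinates]) simp

text \<open>In the product topology on functions of two indices, a product of closed unit discs is
  compact by Tychonoff. The unitary matrices are cut out of it by equations between finitely many
  entries at a time, hence by closed conditions.\<close>

lemma compact_unitary_mats: "compact {U. unitary_mat p U}"
proof -
  have fun_compact: "compact (PiE UNIV S)"
    if "\<And>i. compact (S i)" for S :: "nat \<Rightarrow> 'b::topological_space set"
    using that compactin_PiE[of "\<lambda>_. euclidean" UNIV S]
    by (simp add: euclidean_product_topology)
  let ?B = "PiE UNIV (\<lambda>_. PiE UNIV (\<lambda>_. cball 0 1)) :: (nat \<Rightarrow> nat \<Rightarrow> complex) set"
  let ?C = "{U. (\<forall>i j. p \<le> i \<or> p \<le> j \<longrightarrow> U i j = (0::complex)) \<and>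
      (\<forall>i j. i < p \<longrightarrow> j < p \<longrightarrow> (\<Sum>l<p. U i l * cnj (U j l)) = (if i = j then 1 else 0)) \<and>
      (\<forall>i j. i < p \<longrightarrow> j < p \<longrightarrow> (\<Sum>l<p. cnj (U l i) * U l j) = (if i = j then 1 else 0))}"
  have "compact ?B"
    by (intro fun_compact compact_cball)
  moreover have "closed ?C"
    by (intro closed_Collect_conj closed_Collect_all closed_Collect_imp open_Collect_const
        closed_Collect_eq continuous_intros continuous_on_entry)
  ultimately have "compact (?B \<inter> ?C)"
    by (rule compact_Int_closed)
  moreover have "{U. unitary_mat p U} = ?B \<inter> ?C"
  proof (intro set_eqI iffI)
    fix U assume "U \<in> {U. unitary_mat p U}"
    then have U: "unitary_mat p U" by simp
    then show "U \<in> ?B \<inter> ?C"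
      using unitary_mat_entry_le[OF U] unitary_mat_rows[OF U] unitary_mat_cols[OF U]
      by (auto simp: PiE_UNIV_domain unitary_mat_def vmat_def)
  next
    fix U assume "U \<in> ?B \<inter> ?C"
    then show "U \<in> {U. unitary_mat p U}"
      by (auto intro!: unitary_matI simp: vmat_def)
  qed
  ultimately show ?thesis by simp
qed

section \<open>Plane rotations and the singular value decomposition\<close>

text \<open>The Givens rotation in the plane of coordinates \<open>i\<close>, \<open>j\<close>, with
  rows \<open>(c, s u)\<close> and \<open>(- s cnj u, c)\<close> there. The inner summands test the
  column index, which is the summation index of a product from the left, so that
  \<open>sum.delta\<close> evaluates it.\<close>

definition givens :: "nat \<Rightarrow> nat \<Rightarrow> nat \<Rightarrow> complex \<Rightarrow> real \<Rightarrow> real \<Rightarrow> nat \<Rightarrow> nat \<Rightarrow> complex" where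
  "givens p i j u c s = (\<lambda>a b. if a < p \<and> b < p then
      (if b = a then (if a = i \<or> a = j then of_real c else 1) else 0)
      + (if b = j then (if a = i then of_real s * u else 0) else 0)
      + (if b = i then (if a = j then - of_real s * cnj u else 0) else 0) else 0)"

lemma givens_vmat: "givens p i j u c s \<in> vmat p p"
  by (auto simp: givens_def vmat_def)

lemma cmul_givens_left:
  assumes "i < p" "j < p" "i \<noteq> j" "a < p" "b < p"
  shows "cmul p (givens p i j u c s) M a b =
    (if a = i then of_real c * M i b + of_real s * u * M j b
     else if a = j then of_real c * M j b - of_real s * cnj u * M i b else M a b)"
  using assms
  by (simp add: cmul_apply givens_def distrib_right sum.distrib
      if_distrib[of "\<lambda>x. x * _"] sum.delta sum.delta' cong: if_cong)

lemma cmul_givens_right: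
  assumes "i < p" "j < p" "i \<noteq> j" "a < p" "b < p"
  shows "cmul p M (givens p i j u c s) a b =
    (if b = i then of_real c * M a i - of_real s * cnj u * M a j
     else if b = j then of_real c * M a j + of_real s * u * M a i else M a b)"
proof -
  \<comment> \<open>For a product from the right the row index \<open>l\<close> is summed, so the
    same entries are rewritten with tests on \<open>l\<close>.\<close>
  have "givens p i j u c s l b = 
      (if l = b then (if b = i \<or> b = j then of_real c else 1) else 0)
      + (if l = i then (if b = j then of_real s * u else 0) else 0)
      + (if l = j then (if b = i then - of_real s * cnj u else 0) else 0)" if "l < p" for l
    using that assms by (auto simp: givens_def)
  then show ?thesis
    using assms
    by (simp add: cmul_apply distrib_left sum.distrib mult.commute
      if_distrib[of "\<lambda>x. _ * x"] sum.delta sum.delta' cong: if_cong)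
qed

text \<open>Since \<open>c\<close> and \<open>s\<close> are real, the adjoint is the rotation by the
  opposite angle.\<close>

lemma adj_givens: "i \<noteq> j \<Longrightarrow> adj p (givens p i j u c s) = givens p i j u c (- s)"
  by (auto simp: adj_def givens_def fun_eq_iff)

lemma cmul_givens_inverse:
  assumes "i < p" "j < p" "i \<noteq> j" "cmod u = 1" "c\<^sup>2 + s\<^sup>2 = 1"
  shows "cmul p (givens p i j u c s) (givens p i j u c (- s)) = idm p"
proof (rule vmat_eqI[OF cmul_vmat idm_vmat])
  fix a b assume ab: "a < p" "b < p"
  have u: "u * cnj u = 1"
    using assms(4) by (simp add: complex_norm_square[symmetric])
  have cs: "of_real c * of_real c + of_real s * of_real s = (1::complex)"
    using arg_cong[OF assms(5), of complex_of_real] by (simp add: power2_eq_square)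
  \<comment> \<open>These are the two diagonal entries at \<open>i\<close> and \<open>j\<close>; the
    off-diagonal ones cancel.\<close>
  have "of_real c * of_real c + of_real s * u * (of_real s * cnj u) = (1::complex)"
       "of_real c * of_real c + of_real s * cnj u * (of_real s * u) = (1::complex)"
  proof -
    have "of_real s * u * (of_real s * cnj u) = of_real s * of_real s * (u * cnj u)"
         "of_real s * cnj u * (of_real s * u) = of_real s * of_real s * (u * cnj u)"
      by (simp_all only: mult_ac)
    then show "of_real c * of_real c + of_real s * u * (of_real s * cnj u) = (1::complex)"
       "of_real c * of_real c + of_real s * cnj u * (of_real s * u) = (1::complex)"
      by (simp_all only: cs u mult_1_right)
  qed
  then show "cmul p (givens p i j u c s) (givens p i j u c (- s)) a b = idm p a b"
    using assms(1-3) ab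
    by (auto simp: cmul_givens_left) (auto simp: givens_def idm_def)
qed

lemma unitary_mat_givens:
  assumes "i < p" "j < p" "i \<noteq> j" "cmod u = 1" "c\<^sup>2 + s\<^sup>2 = 1"
  shows "unitary_mat p (givens p i j u c s)"
  using cmul_givens_inverse[OF assms] cmul_givens_inverse[OF assms(1-4), of c "- s"] assms(3,5)
  by (simp add: unitary_mat_def givens_vmat adj_givens)

text \<open>A linear functional on the unit circle is maximal only in the direction of its own
  coefficient vector. Testing with \<open>(A, B)\<close> divided by its norm \<open>R\<close> gives
  \<open>R \<le> A\<close>, which forces \<open>B = 0\<close>. This replaces differentiating at
  angle 0.\<close>

lemma rotation_max_imp_zero:
  fixes A B :: real
  assumes "\<And>c s. c\<^sup>2 + s\<^sup>2 = 1 \<Longrightarrow> A * c + B * s \<le> A"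
  shows "B = 0"
proof (rule ccontr)
  assume "B \<noteq> 0"
  define R where "R = sqrt (A\<^sup>2 + B\<^sup>2)"
  have R2: "R * R = A\<^sup>2 + B\<^sup>2"
    by (simp add: R_def)
  have R: "R > 0"
    using \<open>B \<noteq> 0\<close> by (simp add: R_def sum_power2_gt_zero_iff)
  have "(A / R)\<^sup>2 + (B / R)\<^sup>2 = 1"
  proof -
    have "(A / R)\<^sup>2 + (B / R)\<^sup>2 = (A\<^sup>2 + B\<^sup>2) / (R * R)"
      by (simp add: power_divide add_divide_distrib power2_eq_square)
    then show ?thesis
      using R by (simp flip: R2)
  qed
  from assms[OF this] have "(A\<^sup>2 + B\<^sup>2) / R \<le> A"
    by (simp add: power2_eq_square add_divide_distrib)
  then have "R \<le> A"
    using R by (simp flip: R2)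
  then have "R\<^sup>2 \<le> A\<^sup>2"
    using R by (intro power_mono) auto
  then show False
    using R2 \<open>B \<noteq> 0\<close> by (simp flip: power2_eq_square)
qed

text \<open>A rotation in the plane of \<open>i\<close> and \<open>j\<close> alters only two
  diagonal entries, so this computes the change of the weighted trace.\<close>

lemma sum_two_changes:
  fixes g h :: "nat \<Rightarrow> real"
  assumes "i < p" "j < p" "i \<noteq> j" "\<And>l. l < p \<Longrightarrow> l \<noteq> i \<Longrightarrow> l \<noteq> j \<Longrightarrow> g l = h l"
  shows "(\<Sum>l<p. g l) = (\<Sum>l<p. h l) + (g i - h i) + (g j - h j)"
proof -
  have "(\<Sum>l<p. g l) - (\<Sum>l<p. h l) = (\<Sum>l<p. g l - h l)"
    by (simp add: sum_subtractf)
  also have "\<dots> = (\<Sum>l\<in>{i, j}. g l - h l)"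
    using assms by (intro sum.mono_neutral_right) auto
  finally show ?thesis
    using assms(3) by simp
qed

text \<open>
  Maximise \<open>\<Sum> w\<^sub>l Re (U Z V)\<^sub>l\<^sub>l\<close> over unitary \<open>U, V\<close> for distinct positive weights \<open>w\<^sub>l\<close>. At a maximum
  \<open>M = U Z V\<close>, Givens rotations from the left and from the right show that both \<open>w M\<close> and \<open>M w\<close> are
  Hermitian. Hence \<open>(w\<^sub>i\<^sup>2 - w\<^sub>j\<^sup>2) M\<^sub>i\<^sub>j = 0\<close>.
\<close>
lemma singular_value_decomposition:
  obtains U V where "unitary_mat p U" "unitary_mat p V"
    "\<And>i j. i < p \<Longrightarrow> j < p \<Longrightarrow> i \<noteq> j \<Longrightarrow> cmul p U (cmul p Z V) i j = 0"
proof -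
  \<comment> \<open>For indices below \<open>p\<close> these weights are positive and pairwise
    distinct, so their squares are distinct as well.\<close>
  define w where "w i = real (p - i)" for i
  define \<phi> where "\<phi> M = (\<Sum>l<p. w l * Re (M l l))" for M :: "nat \<Rightarrow> nat \<Rightarrow> complex"
  let ?K = "{U. unitary_mat p U}"
  have entries: "continuous_on (?K \<times> ?K) (\<lambda>x. fst x i j)" "continuous_on (?K \<times> ?K) (\<lambda>x. snd x i j)" for i j
    by (rule continuous_on_compose2[OF continuous_on_entry, where t = UNIV];
        simp add: continuous_on_fst continuous_on_snd)+
  have "continuous_on (?K \<times> ?K) 
      (\<lambda>x. \<Sum>l<p. w l * Re (\<Sum>a<p. fst x l a * (\<Sum>b<p. Z a b * snd x b l)))"
    by (intro continuous_on_sum continuous_on_mult continuous_on_const continuous_on_Re entries)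
  then have "continuous_on (?K \<times> ?K) (\<lambda>x. \<phi> (cmul p (fst x) (cmul p Z (snd x))))"
    by (simp add: \<phi>_def cmul_apply)
  moreover have "?K \<times> ?K \<noteq> {}"
    using unitary_mat_idm by auto
  moreover have "compact (?K \<times> ?K)"
    by (intro compact_Times compact_unitary_mats)
  ultimately have "\<exists>x\<in>?K \<times> ?K. \<forall>y\<in>?K \<times> ?K. \<phi> (cmul p (fst y) (cmul p Z (snd y)))
      \<le> \<phi> (cmul p (fst x) (cmul p Z (snd x)))"
    by (intro continuous_attains_sup)
  then obtain U V where UV: "unitary_mat p U" "unitary_mat p V"
    and max: "\<And>U' V'. unitary_mat p U' \<Longrightarrow> unitary_mat p V' \<Longrightarrow>
        \<phi> (cmul p U' (cmul p Z V')) \<le> \<phi> (cmul p U (cmul p Z V))"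
    by auto
  define M where "M = cmul p U (cmul p Z V)"
  \<comment> \<open>The pairs \<open>(G U, V)\<close> and \<open>(U, V G)\<close> are again
    admissible competitors, so \<open>M\<close> itself is maximal under one-sided unitary
    multiplication.\<close>
  have max_left: "\<phi> (cmul p G M) \<le> \<phi> M" if "unitary_mat p G" for G
    using max[OF unitary_mat_cmul[OF that UV(1)] UV(2)] by (simp add: M_def cmul_assoc)
  have max_right: "\<phi> (cmul p M G) \<le> \<phi> M" if "unitary_mat p G" for G
    using max[OF UV(1) unitary_mat_cmul[OF UV(2) that]] by (simp add: M_def cmul_assoc)
  have "M i j = 0" if ij: "i < p" "j < p" "i \<noteq> j" for i j
  proof -
    \<comment> \<open>The coefficient of \<open>s\<close> in the rotated weighted trace must vanish.
      The phase \<open>u\<close> stays free, so that real and imaginary parts can be extracted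
      later.\<close>
    have left: "w i * Re (u * M j i) = w j * Re (cnj u * M i j)" if u: "cmod u = 1" for u
    proof -
      have "w i * Re (u * M j i) - w j * Re (cnj u * M i j) = 0"
      proof (rule rotation_max_imp_zero)
        fix c s :: real assume "c\<^sup>2 + s\<^sup>2 = 1"
        note max_left[OF unitary_mat_givens[OF ij u this]]
        moreover have "\<phi> (cmul p (givens p i j u c s) M) = \<phi> M
          + (w i * Re (of_real c * M i i + of_real s * u * M j i) - w i * Re (M i i))
          + (w j * Re (of_real c * M j j - of_real s * cnj u * M i j) - w j * Re (M j j))"
          using sum_two_changes[OF ij, of "\<lambda>l. w l * Re (cmul p (givens p i j u c s) M l l)" "\<lambda>l. w l * Re (M l l)"] ij
          by (simp add: \<phi>_def cmul_givens_left)
        ultimately show "(w i * Re (M i i) + w j * Re (M j j)) * c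
            + (w i * Re (u * M j i) - w j * Re (cnj u * M i j)) * s
            \<le> w i * Re (M i i) + w j * Re (M j j)"
          by (simp add: algebra_simps)
      qed
      then show ?thesis by simp
    qed
    \<comment> \<open>Rotating from the right exchanges the roles of \<open>w i\<close> and
      \<open>w j\<close>.\<close>
    have right: "w j * Re (u * M j i) = w i * Re (cnj u * M i j)" if u: "cmod u = 1" for u
    proof -
      have "w j * Re (u * M j i) - w i * Re (cnj u * M i j) = 0"
      proof (rule rotation_max_imp_zero)
        fix c s :: real assume "c\<^sup>2 + s\<^sup>2 = 1"
        note max_right[OF unitary_mat_givens[OF ij u this]]
        moreover have "\<phi> (cmul p M (givens p i j u c s)) = \<phi> M
          + (w i * Re (of_real c * M i i - of_real s * cnj u * M i j) - w i * Re (M i i))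
          + (w j * Re (of_real c * M j j + of_real s * u * M j i) - w j * Re (M j j))"
          using sum_two_changes[OF ij, of "\<lambda>l. w l * Re (cmul p M (givens p i j u c s) l l)" "\<lambda>l. w l * Re (M l l)"] ij
          by (simp add: \<phi>_def cmul_givens_right)
        ultimately show "(w i * Re (M i i) + w j * Re (M j j)) * c
            + (w j * Re (u * M j i) - w i * Re (cnj u * M i j)) * s
            \<le> w i * Re (M i i) + w j * Re (M j j)"
          by (simp add: algebra_simps)
      qed
      then show ?thesis by simp
    qed
    have zero: "x = 0" if "w i * y = w j * x" "w j * y = w i * x" for x y :: real
    proof -
      have "(w i * w i - w j * w j) * x = w i * (w i * x) - w j * (w j * x)"
        by (simp add: algebra_simps)
      also have "\<dots> = w i * (w j * y) - w j * (w i * y)"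
        by (simp only: that)
      finally have "(w i * w i - w j * w j) * x = 0" by simp
      moreover have "w i * w i \<noteq> w j * w j"
        using ij by (auto simp: w_def square_eq_iff of_nat_diff)
      ultimately show ?thesis by simp
    qed
    \<comment> \<open>The phase \<open>u = 1\<close> gives the equations for the real parts;
      \<open>u = \<i>\<close> gives those for the imaginary parts, with a sign at the entry
      \<open>M j i\<close>.\<close>
    show ?thesis
      using zero[of "Re (M j i)" "Re (M i j)"] left[of 1] right[of 1]
        zero[of "- Im (M j i)" "Im (M i j)"] left[of \<i>] right[of \<i>]
      by (simp add: complex_eq_iff)
  qed
  then show ?thesis
    using UV that by (simp add: M_def)
qed

section \<open>Vanishing of \<open>delta\<close> and the action of complex scalars\<close>

text \<open>The value is 0 exactly when the supremum is infinite. Every real \<open>s\<close> then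
  lies below some admissible \<open>t\<close>, and admissibility of \<open>t\<close> covers all
  smaller parameters.\<close>

lemma delta_eq_0_iff:
  "delta D n m a c b = 0 \<longleftrightarrow> (\<forall>s\<ge>0. blk n m a (\<lambda>i j. s *\<^sub>R b i j) c \<in> D (n + m))"
proof -
  define T where "T = {t::ennreal. \<forall>s::real. 0 \<le> s \<longrightarrow> ennreal s \<le> t \<longrightarrow>
                 blk n m a (\<lambda>i j. s *\<^sub>R b i j) c \<in> D (n + m)}"
  have "delta D n m a c b = 0 \<longleftrightarrow> Sup T = top"
  proof -
    have "(if S = 0 then top else if S = top then 0 else inverse S) = 0 \<longleftrightarrow> S = top" for S :: ennreal
      by (auto simp: ennreal_inverse_eq_0_iff)
    then show ?thesis
      by (simp only: delta_def T_def Let_def)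
  qed
  also have "\<dots> \<longleftrightarrow> (\<forall>s\<ge>0. blk n m a (\<lambda>i j. s *\<^sub>R b i j) c \<in> D (n + m))"
  proof (intro iffI allI impI)
    fix s :: real assume "Sup T = top" "0 \<le> s"
    then have "ennreal s < Sup T" by (simp only: ennreal_less_top)
    then obtain t where "t \<in> T" "ennreal s < t"
      by (auto simp: less_Sup_iff)
    then show "blk n m a (\<lambda>i j. s *\<^sub>R b i j) c \<in> D (n + m)"
      using \<open>0 \<le> s\<close> by (auto simp: T_def)
  next
    assume "\<forall>s\<ge>0. blk n m a (\<lambda>i j. s *\<^sub>R b i j) c \<in> D (n + m)"
    then have "T = UNIV" by (auto simp: T_def)
    then show "Sup T = top" by simp
  qed
  finally show ?thesis .
qed

lemma cscale_zero_left [simp]: "cscale J 0 v = 0"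
  and cscale_one [simp]: "cscale J 1 v = v"
  and cscale_of_real: "cscale J (of_real s) v = s *\<^sub>R v"
  and cscale_add_left: "cscale J (z + w) v = cscale J z v + cscale J w v"
  by (simp_all add: cscale_def algebra_simps)

lemma cscale_sum_left: "cscale J (\<Sum>i\<in>A. f i) v = (\<Sum>i\<in>A. cscale J (f i) v)"
  by (induction A rule: infinite_finite_induct) (simp_all add: cscale_add_left)

context
  fixes J :: "'a::real_vector \<Rightarrow> 'a"
  assumes J: "complex_structure J"
begin

lemma J_linear: "linear J" and J_J: "J (J v) = - v"
  using J by (simp_all add: complex_structure_def)

lemma cscale_linear: "linear (cscale J z)"
  unfolding cscale_def
  by (intro linearI) (simp_all add: linear_add[OF J_linear] linear_scale[OF J_linear] algebra_simps)

lemma cscale_zero_right [simp]: "cscale J z 0 = 0"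
  by (rule linear_0[OF cscale_linear])

lemma cscale_add_right: "cscale J z (v + w) = cscale J z v + cscale J z w"
  by (rule linear_add[OF cscale_linear])

lemma cscale_sum_right: "cscale J z (\<Sum>i\<in>A. f i) = (\<Sum>i\<in>A. cscale J z (f i))"
  by (rule linear_sum[OF cscale_linear])

text \<open>The identity \<open>J (J v) = - v\<close> supplies the square of the imaginary
  unit.\<close>

lemma cscale_cscale: "cscale J z (cscale J w v) = cscale J (z * w) v"
  by (simp add: cscale_def linear_add[OF J_linear] linear_scale[OF J_linear] J_J algebra_simps)

end

section \<open>Linear pencils, direct sums and similarities\<close>

text \<open>An index is split as \<open>k * i + \<rho>\<close>, with block number \<open>i\<close>
  and position \<open>\<rho>\<close> inside the block.\<close>

lemma sum_div_mod:
  fixes g :: "nat \<Rightarrow> 'b::comm_monoid_add"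
  shows "(\<Sum>r<k * p. g r) = (\<Sum>i<p. \<Sum>\<rho><k. g (k * i + \<rho>))"
proof -
  have "(\<Sum>r<k * p. g r) = (\<Sum>i<p. sum g {i * k..<i * k + k})"
    by (simp add: sum.nat_group mult.commute)
  also have "\<dots> = (\<Sum>i<p. \<Sum>\<rho><k. g (k * i + \<rho>))"
  proof (rule sum.cong)
    fix i
    show "sum g {i * k..<i * k + k} = (\<Sum>\<rho><k. g (k * i + \<rho>))"
      using sum.shift_bounds_nat_ivl[of g 0 "i * k" k]
      by (simp add: atLeast0LessThan add.commute mult.commute)
  qed simp
  finally show ?thesis .
qed

lemma div_less_iff: "0 < k \<Longrightarrow> r div k < p \<longleftrightarrow> r < k * (p::nat)"
  by (simp add: div_less_iff_less_mult mult.commute)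

lemma block_index_less: "i < p \<Longrightarrow> \<rho> < k \<Longrightarrow> k * i + \<rho> < k * (p::nat)"
  using mult_le_mono2[of "Suc i" p k] by simp

text \<open>This is \<open>I \<otimes> A + Z \<otimes> B\<close>. The scalar matrix acts on the
  outer index \<open>r div k\<close>, matching the convention of \<open>bleft\<close> and
  \<open>bright\<close>.\<close>

definition pencil :: "('a::real_vector \<Rightarrow> 'a) \<Rightarrow> nat \<Rightarrow> (nat \<Rightarrow> nat \<Rightarrow> 'a) \<Rightarrow> (nat \<Rightarrow> nat \<Rightarrow> 'a) \<Rightarrow>
    nat \<Rightarrow> (nat \<Rightarrow> nat \<Rightarrow> complex) \<Rightarrow> nat \<Rightarrow> nat \<Rightarrow> 'a" where
  "pencil J k A B p Z = (\<lambda>r s. if r < k * p \<and> s < k * p then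
      (if r div k = s div k then A (r mod k) (s mod k) else 0)
      + cscale J (Z (r div k) (s div k)) (B (r mod k) (s mod k)) else 0)"

lemma pencil_vmat: "pencil J k A B p Z \<in> vmat (k * p) (k * p)"
  by (auto simp: pencil_def vmat_def)

lemma pencil_block:
  "i < p \<Longrightarrow> j < p \<Longrightarrow> \<rho> < k \<Longrightarrow> \<sigma> < k \<Longrightarrow>
    pencil J k A B p Z (k * i + \<rho>) (k * j + \<sigma>) =
      (if i = j then A \<rho> \<sigma> else 0) + cscale J (Z i j) (B \<rho> \<sigma>)"
  by (simp add: pencil_def block_index_less)

lemma blk_vmat: "blk n m a b c \<in> vmat (n + m) (n + m)"
  by (auto simp: blk_def vmat_def)

lemma dsum_vmat: "dsum n m a c \<in> vmat (n + m) (n + m)"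
  by (simp add: dsum_def blk_vmat)

lemma pencil_dsum:
  assumes "0 < k"
  shows "pencil J k A B (p + q) (dsum p q Z W) =
    dsum (k * p) (k * q) (pencil J k A B p Z) (pencil J k A B q W)"
proof (intro ext)
  fix r s
  have sub: "(r - k * p) div k = r div k - p" "(r - k * p) mod k = r mod k" if "k * p \<le> r" for r
  proof -
    define t where "t = r - k * p"
    have r: "r = k * p + t" using that by (simp add: t_def)
    show "(r - k * p) div k = r div k - p" "(r - k * p) mod k = r mod k"
      unfolding r using assms by simp_all
  qed
  have lt: "r div k < p \<longleftrightarrow> r < k * p" "r div k < p + q \<longleftrightarrow> r < k * p + k * q"
      "p \<le> r div k \<longleftrightarrow> k * p \<le> r" for r
    using div_less_iff[OF assms, of r p] div_less_iff[OF assms, of r "p + q"]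
    by (simp_all add: distrib_left linorder_not_less[symmetric, of p] linorder_not_less[symmetric, of "k * p"]
        del: not_less)
  have "r < k * p + k * q \<longleftrightarrow> r - k * p < k * q" if "k * p \<le> r" for r
    using that by auto
  moreover have "r div k = s div k \<longleftrightarrow> r div k - p = s div k - p" if "k * p \<le> r" "k * p \<le> s"
    using that lt(3)[of r] lt(3)[of s] by auto
  \<comment> \<open>In the off-diagonal blocks the outer indices lie on different sides of
    \<open>p\<close>, so \<open>A\<close> contributes nothing there.\<close>
  moreover have "r div k \<noteq> s div k" if "r < k * p \<and> k * p \<le> s \<or> s < k * p \<and> k * p \<le> r"
    using that lt[of r] lt[of s] by auto
  ultimately show "pencil J k A B (p + q) (dsum p q Z W) r s =
    dsum (k * p) (k * q) (pencil J k A B p Z) (pencil J k A B q W) r s"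
    by (cases "r < k * p"; cases "s < k * p")
      (auto simp: pencil_def dsum_def blk_def lt sub not_less distrib_left)
qed

context
  fixes J :: "'a::real_vector \<Rightarrow> 'a"
  assumes J: "complex_structure J"
begin

text \<open>With \<open>P\<close> as a row and \<open>Q\<close> as a column this reads \<open>P (I
  \<alpha> + Z \<beta>) Q = (P Q) \<alpha> + (P Z Q) \<beta>\<close>. It serves both for
  similarities and for unitary conjugations of pencils.\<close>

lemma pencil_block_conj:
  fixes p :: nat
  shows "(\<Sum>j<p. cscale J (Q j) (\<Sum>i<p. cscale J (P i) ((if i = j then \<alpha> else 0) + cscale J (Z i j) \<beta>)))
    = cscale J (\<Sum>i<p. P i * Q i) \<alpha> + cscale J (\<Sum>i<p. P i * (\<Sum>j<p. Z i j * Q j)) \<beta>"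
proof -
  have "cscale J (Q j) (\<Sum>i<p. cscale J (P i) ((if i = j then \<alpha> else 0) + cscale J (Z i j) \<beta>))
     = cscale J (P j * Q j) \<alpha> + (\<Sum>i<p. cscale J (P i * (Z i j * Q j)) \<beta>)" if "j < p" for j
  proof -
    have "(\<Sum>i<p. cscale J (P i) ((if i = j then \<alpha> else 0) + cscale J (Z i j) \<beta>))
      = (\<Sum>i<p. (if i = j then cscale J (P i) \<alpha> else 0) + cscale J (P i * Z i j) \<beta>)"
      by (intro sum.cong)
        (auto simp: cscale_add_right[OF J] cscale_cscale[OF J] cscale_zero_right[OF J])
    also have "\<dots> = cscale J (P j) \<alpha> + (\<Sum>i<p. cscale J (P i * Z i j) \<beta>)"
      using that by (simp add: sum.distrib)
    finally show ?thesis
      by (simp add: cscale_add_right[OF J] cscale_sum_right[OF J] cscale_cscale[OF J] mult_ac)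
  qed
  then have "(\<Sum>j<p. cscale J (Q j) (\<Sum>i<p. cscale J (P i) ((if i = j then \<alpha> else 0) + cscale J (Z i j) \<beta>)))
    = (\<Sum>j<p. cscale J (P j * Q j) \<alpha>) + (\<Sum>j<p. \<Sum>i<p. cscale J (P i * (Z i j * Q j)) \<beta>)"
    by (simp add: sum.distrib)
  also have "(\<Sum>j<p. \<Sum>i<p. cscale J (P i * (Z i j * Q j)) \<beta>) = (\<Sum>i<p. \<Sum>j<p. cscale J (P i * (Z i j * Q j)) \<beta>)"
    by (rule sum.swap)
  finally show ?thesis
    by (simp add: cscale_sum_left sum_distrib_left)
qed

text \<open>Multiplying by \<open>S \<otimes> I\<close> and \<open>T \<otimes> I\<close> gives
  \<open>S T \<otimes> A + S Z T \<otimes> B\<close>, and \<open>S T\<close> is the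
  identity.\<close>

lemma pencil_similarity:
  assumes "0 < k" and ST: "cmul p S T = idm p"
  shows "bright J k p T (bleft J k p S (pencil J k A B p Z)) = pencil J k A B p (cmul p S (cmul p Z T))"
proof (rule vmat_eqI[OF _ pencil_vmat])
  show "bright J k p T (bleft J k p S (pencil J k A B p Z)) \<in> vmat (k * p) (k * p)"
    by (auto simp: bright_def vmat_def)
  fix r s assume rs: "r < k * p" "s < k * p"
  define i j \<rho> \<sigma> where "i = r div k" "j = s div k" "\<rho> = r mod k" "\<sigma> = s mod k"
  then have r: "r = k * i + \<rho>" "i < p" "\<rho> < k" and s: "s = k * j + \<sigma>" "j < p" "\<sigma> < k"
    using rs \<open>0 < k\<close> by (simp_all add: div_less_iff)
  have "(\<Sum>l<p. S i l * T l j) = (if i = j then 1 else 0)"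
    using r s fun_cong[OF fun_cong[OF ST], of i j] by (simp add: cmul_apply idm_def)
  then have "cscale J (\<Sum>l<p. S i l * T l j) v = (if i = j then v else 0)" for v
    by simp
  then show "bright J k p T (bleft J k p S (pencil J k A B p Z)) r s
      = pencil J k A B p (cmul p S (cmul p Z T)) r s"
    using r s
    by (simp add: bright_def bleft_def pencil_block block_index_less pencil_block_conj cmul_apply)
qed

end

section \<open>Unitary conjugation of pencils\<close>

text \<open>
  After moving the row index \<open>\<rho> = r mod k\<close> in front, this is \<open>U\<close> repeated for \<open>\<rho> < n\<close> and \<open>V\<close> repeated
  for \<open>\<rho> \<ge> n\<close>, so conjugation by it acts on \<open>Z \<otimes> B\<close> as \<open>Z \<mapsto> U Z V\<^sup>*\<close>.
\<close>
definition block_unitary ::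
  "nat \<Rightarrow> nat \<Rightarrow> nat \<Rightarrow> (nat \<Rightarrow> nat \<Rightarrow> complex) \<Rightarrow> (nat \<Rightarrow> nat \<Rightarrow> complex) \<Rightarrow> nat \<Rightarrow> nat \<Rightarrow> complex" where
  "block_unitary n k p U V = (\<lambda>r s. if r < k * p \<and> s < k * p \<and> r mod k = s mod k
      then (if r mod k < n then U else V) (r div k) (s div k) else 0)"

lemma block_unitary_block:
  assumes "i < p" "j < p" "\<rho> < k" "\<sigma> < k"
  shows "block_unitary n k p U V (k * i + \<rho>) (k * j + \<sigma>) =
    (if \<rho> = \<sigma> then (if \<rho> < n then U else V) i j else 0)"
  using assms by (simp add: block_unitary_def block_index_less)

text \<open>Within each block a row has at most one nonzero entry, at the same inner position
  \<open>\<rho>\<close>. A general \<open>g\<close> covers products of scalar matrices as well as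
  scalars acting on vectors.\<close>

lemma block_unitary_row_sum:
  fixes g :: "complex \<Rightarrow> nat \<Rightarrow> 'b::comm_monoid_add"
  assumes "i < p" "\<rho> < k" "\<And>l. g 0 l = 0"
  shows "(\<Sum>l<k * p. g (block_unitary n k p U V (k * i + \<rho>) l) l) =
    (\<Sum>l<p. g ((if \<rho> < n then U else V) i l) (k * l + \<rho>))"
  unfolding sum_div_mod
proof (rule sum.cong)
  fix l assume "l \<in> {..<p}"
  then have "(\<Sum>\<sigma><k. g (block_unitary n k p U V (k * i + \<rho>) (k * l + \<sigma>)) (k * l + \<sigma>)) =
    (\<Sum>\<sigma><k. if \<sigma> = \<rho> then g ((if \<rho> < n then U else V) i l) (k * l + \<rho>) else 0)"
    using assms by (intro sum.cong) (auto simp: block_unitary_block)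
  then show "(\<Sum>\<sigma><k. g (block_unitary n k p U V (k * i + \<rho>) (k * l + \<sigma>)) (k * l + \<sigma>)) =
      g ((if \<rho> < n then U else V) i l) (k * l + \<rho>)"
    using assms by simp
qed simp

lemma adj_block_unitary:
  assumes "0 < k"
  shows "adj (k * p) (block_unitary n k p U V) = block_unitary n k p (adj p U) (adj p V)"
  using assms by (auto simp: adj_def block_unitary_def fun_eq_iff div_less_iff)

lemma block_unitary_cmul_adj:
  assumes "0 < k" "unitary_mat p U" "unitary_mat p V"
  shows "cmul (k * p) (block_unitary n k p U V) (block_unitary n k p (adj p U) (adj p V)) = idm (k * p)"
proof (rule vmat_eqI[OF cmul_vmat idm_vmat])
  fix r s assume rs: "r < k * p" "s < k * p"
  define i j \<rho> \<sigma> where "i = r div k" "j = s div k" "\<rho> = r mod k" "\<sigma> = s mod k"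
  then have r: "r = k * i + \<rho>" "i < p" "\<rho> < k" and s: "s = k * j + \<sigma>" "j < p" "\<sigma> < k"
    using rs \<open>0 < k\<close> by (simp_all add: div_less_iff)
  let ?W = "if \<rho> < n then U else V"
  have "cmul (k * p) (block_unitary n k p U V) (block_unitary n k p (adj p U) (adj p V)) r s =
      (\<Sum>l<p. ?W i l * block_unitary n k p (adj p U) (adj p V) (k * l + \<rho>) s)"
    using rs r block_unitary_row_sum[of i p \<rho> k
        "\<lambda>x l. x * block_unitary n k p (adj p U) (adj p V) l s" n U V]
    by (simp add: cmul_apply)
  also have "\<dots> = (\<Sum>l<p. if \<rho> = \<sigma> then ?W i l * adj p ?W l j else 0)"
    using r s by (intro sum.cong) (auto simp: block_unitary_block)
  also have "\<dots> = (if \<rho> = \<sigma> then cmul p ?W (adj p ?W) i j else 0)"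
    using r s by (simp add: cmul_apply)
  also have "cmul p ?W (adj p ?W) = idm p"
    using assms by (simp add: unitary_mat_def)
  also have "(if \<rho> = \<sigma> then idm p i j else 0) = idm (k * p) r s"
  proof -
    have "r = s \<longleftrightarrow> i = j \<and> \<rho> = \<sigma>"
      using \<open>\<rho> = r mod k\<close> \<open>\<sigma> = s mod k\<close> \<open>i = r div k\<close> \<open>j = s div k\<close> r(1) s(1) by metis
    then show ?thesis
      using rs r(2) by (auto simp: idm_def)
  qed
  finally show "cmul (k * p) (block_unitary n k p U V) (block_unitary n k p (adj p U) (adj p V)) r s
      = idm (k * p) r s" .
qed

lemma unitary_mat_block_unitary:
  assumes "0 < k" and U: "unitary_mat p U" and V: "unitary_mat p V"
  shows "unitary_mat (k * p) (block_unitary n k p U V)"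
proof -
  have "block_unitary n k p U V \<in> vmat (k * p) (k * p)"
    by (auto simp: block_unitary_def vmat_def)
  moreover have "adj p (adj p U) = U" "adj p (adj p V) = V"
    using U V by (simp_all add: adj_adj unitary_mat_def)
  ultimately show ?thesis
    using block_unitary_cmul_adj[OF assms, of n]
      block_unitary_cmul_adj[OF \<open>0 < k\<close> unitary_mat_adj[OF U] unitary_mat_adj[OF V], of n]
    by (simp add: unitary_mat_def adj_block_unitary[OF \<open>0 < k\<close>])
qed

section \<open>Pencils with values in the noncommutative set\<close>

context
  fixes J :: "'a::real_vector \<Rightarrow> 'a" and D :: "nat \<Rightarrow> (nat \<Rightarrow> nat \<Rightarrow> 'a) set"
  assumes J: "complex_structure J"
    and ncD: "nc_set D"
    and P2: "\<forall>n\<ge>1. \<forall>a\<in>D n. \<forall>U. unitary_mat n U \<longrightarrow> bright J 1 n (adj n U) (bleft J 1 n U a) \<in> D n"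
begin

text \<open>Conjugate by the block unitary built from \<open>U\<close> and \<open>adj p V\<close>.
  \<open>A\<close> couples only positions on the same side of \<open>n\<close>, where the two
  unitary factors cancel. \<open>B\<close> couples positions below \<open>n\<close> with positions
  from \<open>n\<close> on, so \<open>Z\<close> becomes \<open>U Z V\<close>; the second unitary is
  \<open>adj p V\<close> because conjugation takes the adjoint on the right.\<close>

lemma pencil_unitary_mem:
  assumes "0 < k" "0 < p" and U: "unitary_mat p U" and V: "unitary_mat p V"
    and A: "\<And>\<rho> \<sigma>. \<rho> < k \<Longrightarrow> \<sigma> < k \<Longrightarrow> (\<rho> < n) \<noteq> (\<sigma> < n) \<Longrightarrow> A \<rho> \<sigma> = 0"
    and B: "\<And>\<rho> \<sigma>. \<rho> < k \<Longrightarrow> \<sigma> < k \<Longrightarrow> \<not> (\<rho> < n \<and> n \<le> \<sigma>) \<Longrightarrow> B \<rho> \<sigma> = 0"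
    and mem: "pencil J k A B p Z \<in> D (k * p)"
  shows "pencil J k A B p (cmul p U (cmul p Z V)) \<in> D (k * p)"
proof -
  define X where "X = block_unitary n k p U (adj p V)"
  let ?F = "pencil J k A B p"
  let ?C = "bright J 1 (k * p) (adj (k * p) X) (bleft J 1 (k * p) X (?F Z))"
  have V': "unitary_mat p (adj p V)"
    using V by (rule unitary_mat_adj)
  have "?C \<in> D (k * p)"
    using P2 mem assms(1,2) unitary_mat_block_unitary[OF \<open>0 < k\<close> U V'] by (auto simp: X_def)
  moreover have "?C = ?F (cmul p U (cmul p Z V))"
  proof (rule vmat_eqI[OF _ pencil_vmat])
    show "?C \<in> vmat (k * p) (k * p)"
      by (auto simp: bright_def vmat_def)
    fix r s assume rs: "r < k * p" "s < k * p"
    define i j \<rho> \<sigma> where "i = r div k" "j = s div k" "\<rho> = r mod k" "\<sigma> = s mod k"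
    then have r: "r = k * i + \<rho>" "i < p" "\<rho> < k" and s: "s = k * j + \<sigma>" "j < p" "\<sigma> < k"
      using rs \<open>0 < k\<close> by (simp_all add: div_less_iff)
    \<comment> \<open>The unitary that acts at inner position \<open>\<rho>\<close>.\<close>
    define W where "W \<rho> = (if \<rho> < n then U else adj p V)" for \<rho>
    have "?C r s = (\<Sum>t<k * p. cscale J (cnj (X s t)) (\<Sum>q<k * p. cscale J (X r q) (?F Z q t)))"
      using rs by (simp add: bright_def bleft_def adj_def)
    also have "\<dots> = (\<Sum>l<p. cscale J (cnj (W \<sigma> j l)) (\<Sum>q<k * p. cscale J (X r q) (?F Z q (k * l + \<sigma>))))"
      using block_unitary_row_sum[of j p \<sigma> k "\<lambda>x t. cscale J (cnj x) (\<Sum>q<k * p. cscale J (X r q) (?F Z q t))" n U "adj p V"] s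
      by (simp add: X_def W_def)
    also have "\<dots> = (\<Sum>l<p. cscale J (cnj (W \<sigma> j l)) (\<Sum>h<p. cscale J (W \<rho> i h) (?F Z (k * h + \<rho>) (k * l + \<sigma>))))"
      using block_unitary_row_sum[of i p \<rho> k "\<lambda>x q. cscale J x (?F Z q (k * l + \<sigma>))" n U "adj p V" for l] r
      by (simp add: X_def W_def)
    also have "\<dots> = (\<Sum>l<p. cscale J (cnj (W \<sigma> j l)) (\<Sum>h<p. cscale J (W \<rho> i h)
        ((if h = l then A \<rho> \<sigma> else 0) + cscale J (Z h l) (B \<rho> \<sigma>))))"
      using r s by (simp add: pencil_block)
    also have "\<dots> = cscale J (\<Sum>h<p. W \<rho> i h * cnj (W \<sigma> j h)) (A \<rho> \<sigma>)
        + cscale J (\<Sum>h<p. W \<rho> i h * (\<Sum>l<p. Z h l * cnj (W \<sigma> j l))) (B \<rho> \<sigma>)"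
      by (rule pencil_block_conj[OF J])
    also have "cscale J (\<Sum>h<p. W \<rho> i h * cnj (W \<sigma> j h)) (A \<rho> \<sigma>) = (if i = j then A \<rho> \<sigma> else 0)"
    proof (cases "(\<rho> < n) = (\<sigma> < n)")
      case True
      then have "W \<sigma> = W \<rho>" by (simp add: W_def)
      moreover have "unitary_mat p (W \<rho>)" using U V' by (simp add: W_def)
      ultimately show ?thesis
        using r s by (simp add: unitary_mat_rows)
    next
      case False
      then show ?thesis
        using A r s cscale_zero_right[OF J] by simp
    qed
    also have "cscale J (\<Sum>h<p. W \<rho> i h * (\<Sum>l<p. Z h l * cnj (W \<sigma> j l))) (B \<rho> \<sigma>)
        = cscale J (cmul p U (cmul p Z V) i j) (B \<rho> \<sigma>)"
    proof (cases "\<rho> < n \<and> n \<le> \<sigma>")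
      case True
      then show ?thesis
        using r s by (simp add: W_def cmul_apply adj_def)
    next
      case False
      then show ?thesis
        using B r s cscale_zero_right[OF J] by simp
    qed
    finally show "?C r s = ?F (cmul p U (cmul p Z V)) r s"
      using r s by (simp add: pencil_block)
  qed
  ultimately show ?thesis by simp
qed

lemma pencil_mem:
  assumes n: "1 \<le> n" and m: "1 \<le> m" and p: "1 \<le> p"
    and mem: "\<And>s. 0 \<le> s \<Longrightarrow> blk n m a (\<lambda>i j. s *\<^sub>R b i j) c \<in> D (n + m)"
  shows "pencil J (n + m) (dsum n m a c) (blk n m (\<lambda>_ _. 0) b (\<lambda>_ _. 0)) p Z \<in> D ((n + m) * p)"
proof -
  define k where "k = n + m"
  define A where "A = dsum n m a c"
  define B where "B = blk n m (\<lambda>_ _. 0) b (\<lambda>_ _. 0)"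
  let ?F = "pencil J k A B"
  have k: "0 < k" using n by (simp add: k_def)
  have A: "A \<rho> \<sigma> = 0" if "(\<rho> < n) \<noteq> (\<sigma> < n)" for \<rho> \<sigma>
    using that by (auto simp: A_def dsum_def blk_def)
  have B: "B \<rho> \<sigma> = 0" if "\<not> (\<rho> < n \<and> n \<le> \<sigma>)" for \<rho> \<sigma>
    using that by (auto simp: B_def blk_def)
  have conj: "?F p (cmul p U (cmul p Z V)) \<in> D (k * p)"
    if "?F p Z \<in> D (k * p)" "1 \<le> p" "unitary_mat p U" "unitary_mat p V" for p Z U V
    using pencil_unitary_mem[of k p U V n A B Z] that k A B by simp
  \<comment> \<open>Polar form \<open>z = u * cmod z\<close>: the hypothesis covers the nonnegative
    real parameter, and a unitary of size 1 supplies the phase.\<close>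
  have level1: "?F 1 Z \<in> D k" for Z
  proof -
    define z where "z = Z 0 0"
    \<comment> \<open>At \<open>z = 0\<close> the phase is set to 1, because
      \<open>sgn 0 = 0\<close> is not unimodular.\<close>
    define u where "u = (if z = 0 then 1 else sgn z)"
    define U where "U = (\<lambda>i::nat. \<lambda>j::nat. if i = 0 \<and> j = 0 then u else 0)"
    define Y where "Y = (\<lambda>i::nat. \<lambda>j::nat. if i = 0 \<and> j = 0 then complex_of_real (cmod z) else 0)"
    have "cmod u = 1" by (simp add: u_def norm_sgn)
    then have "unitary_mat 1 U"
      by (intro unitary_matI) (auto simp: U_def vmat_def complex_norm_square[symmetric] mult.commute[of "cnj u"])
    moreover have "?F 1 Y = blk n m a (\<lambda>i j. cmod z *\<^sub>R b i j) c"
      by (auto simp: pencil_def fun_eq_iff blk_def Y_def k_def A_def B_def dsum_def cscale_of_real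
          cscale_zero_right[OF J])
    ultimately have "?F 1 (cmul 1 U (cmul 1 Y (idm 1))) \<in> D (k * 1)"
      using mem[of "cmod z"] by (intro conj) (simp_all add: unitary_mat_idm k_def)
    moreover have "u * of_real (cmod z) = z"
      by (simp add: u_def sgn_eq)
    then have "cmul 1 U (cmul 1 Y (idm 1)) 0 0 = Z 0 0"
      by (simp add: cmul_def U_def Y_def idm_def flip: z_def)
    then have "?F 1 (cmul 1 U (cmul 1 Y (idm 1))) = ?F 1 Z"
      by (auto simp: pencil_def fun_eq_iff)
    ultimately show ?thesis by simp
  qed
  \<comment> \<open>Induction on the size, splitting off the last diagonal entry as a direct summand
    of size 1.\<close>
  have diag: "?F p M \<in> D (k * p)" if "1 \<le> p" "\<And>i j. i < p \<Longrightarrow> j < p \<Longrightarrow> i \<noteq> j \<Longrightarrow> M i j = 0" for p M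
    using that
  proof (induction p rule: nat_induct_at_least)
    case base
    then show ?case using level1 by simp
  next
    case (Suc p)
    let ?M = "dsum p 1 M (\<lambda>_ _. M p p)"
    have "dsum (k * p) (k * 1) (?F p M) (?F 1 (\<lambda>_ _. M p p)) \<in> D (k * p + k)"
      using ncD Suc level1[of "\<lambda>_ _. M p p"] k by (simp add: nc_set_def)
    then have "?F (p + 1) ?M \<in> D (k * p + k)"
      by (simp only: pencil_dsum[OF k])
    moreover have "?M i j = M i j" if "i < Suc p" "j < Suc p" for i j
      using that Suc.prems[of i j] by (auto simp: dsum_def blk_def less_Suc_eq)
    then have "?F (p + 1) ?M = ?F (p + 1) M"
      using k div_less_iff[OF k, of _ "Suc p"] by (auto simp: pencil_def fun_eq_iff)
    ultimately show ?case by (simp add: add.commute)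
  qed
  obtain U V where U: "unitary_mat p U" and V: "unitary_mat p V"
    and M: "\<And>i j. i < p \<Longrightarrow> j < p \<Longrightarrow> i \<noteq> j \<Longrightarrow> cmul p U (cmul p Z V) i j = 0"
    using singular_value_decomposition[of p Z] by blast
  \<comment> \<open>Undoing the decomposition: the diagonal matrix is multiplied back by the adjoint
    unitaries.\<close>
  have "?F p (cmul p (adj p U) (cmul p (cmul p U (cmul p Z V)) (adj p V))) \<in> D (k * p)"
    using p U V M by (intro conj diag unitary_mat_adj) auto
  also have "cmul p (adj p U) (cmul p (cmul p U (cmul p Z V)) (adj p V)) =
      cmul p (cmul p (adj p U) U) (cmul p Z (cmul p V (adj p V)))"
    by (simp add: cmul_assoc)
  also have "\<dots> = cmul p (idm p) (cmul p Z (idm p))"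
    using U V by (simp add: unitary_mat_def)
  \<comment> \<open>\<open>Z\<close> may be nonzero outside its index range, so equality with it is
    claimed only for entries below \<open>p\<close>; the pencil reads no others.\<close>
  also have "?F p \<dots> = ?F p Z"
  proof -
    have "cmul p (idm p) (cmul p Z (idm p)) i j = Z i j" if "i < p" "j < p" for i j
      using that
      by (simp add: cmul_apply idm_def if_distrib[of "\<lambda>x. x * _"] if_distrib[of "\<lambda>x. _ * x"]
          cong: if_cong)
    then show ?thesis
      using k div_less_iff[OF k, of _ p] by (auto simp: pencil_def fun_eq_iff)
  qed
  finally show ?thesis by (simp add: k_def A_def B_def)
qed

end

section \<open>Shears and the values of noncommutative functions\<close>

text \<open>The unipotent matrix with identity blocks of size \<open>p\<close> on the diagonal and
  \<open>x\<close> times the identity in the upper right block.\<close>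

definition shear :: "nat \<Rightarrow> complex \<Rightarrow> nat \<Rightarrow> nat \<Rightarrow> complex" where
  "shear p x = (\<lambda>i j. if i < p + p \<and> j < p + p then
      (if j = i then 1 else 0) + (if j = i + p then x else 0) else 0)"

lemma shear_vmat: "shear p x \<in> vmat (p + p) (p + p)"
  by (auto simp: shear_def vmat_def)

lemma shear_row_sum:
  fixes g :: "complex \<Rightarrow> nat \<Rightarrow> 'b::comm_monoid_add"
  assumes "0 < p" "i < p + p" "\<And>l. g 0 l = 0"
  shows "(\<Sum>l<p + p. g (shear p x i l) l) = g 1 i + (if i < p then g x (i + p) else 0)"
proof -
  have "(\<Sum>l<p + p. g (shear p x i l) l) =
      (\<Sum>l<p + p. (if l = i then g 1 i else 0) + (if l = i + p then g x (i + p) else 0))"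
    using assms by (intro sum.cong) (auto simp: shear_def)
  also have "\<dots> = g 1 i + (if i < p then g x (i + p) else 0)"
    using assms by (simp add: sum.distrib)
  finally show ?thesis .
qed

lemma shear_col_sum:
  fixes g :: "complex \<Rightarrow> nat \<Rightarrow> 'b::comm_monoid_add"
  assumes "0 < p" "j < p + p" "\<And>l. g 0 l = 0"
  shows "(\<Sum>l<p + p. g (shear p x l j) l) = g 1 j + (if p \<le> j then g x (j - p) else 0)"
proof -
  have "(\<Sum>l<p + p. g (shear p x l j) l) =
      (\<Sum>l<p + p. (if l = j then g 1 j else 0) + (if l = j - p then (if p \<le> j then g x (j - p) else 0) else 0))"
    using assms by (intro sum.cong) (auto simp: shear_def)
  also have "\<dots> = g 1 j + (if p \<le> j then g x (j - p) else 0)"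
    using assms less_imp_diff_less[of j "p + p" p] by (simp add: sum.distrib)
  finally show ?thesis .
qed

lemma cmul_shear_inverse: "0 < p \<Longrightarrow> cmul (p + p) (shear p x) (shear p (- x)) = idm (p + p)"
  by (rule vmat_eqI[OF cmul_vmat idm_vmat])
    (auto simp: cmul_apply shear_row_sum[where g = "\<lambda>y l. y * shear p (- x) l _"], auto simp: shear_def idm_def)

text \<open>The left factor with \<open>- s\<close> puts \<open>- s c\<close> into the corner and
  the right factor with \<open>s\<close> adds \<open>s a\<close>, so the corner is
  \<open>s (a - c)\<close>.\<close>

lemma shear_dsum:
  assumes J: "complex_structure J" and k: "0 < k" and p: "0 < p"
  shows "bright J k (p + p) (shear p (of_real s)) (bleft J k (p + p) (shear p (- of_real s)) (dsum (k * p) (k * p) a c))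
    = blk (k * p) (k * p) a (\<lambda>i j. s *\<^sub>R (a i j - c i j)) c"
proof (rule vmat_eqI)
  let ?F = "dsum (k * p) (k * p) a c"
  let ?G = "bleft J k (p + p) (shear p (- of_real s)) ?F"
  show "bright J k (p + p) (shear p (of_real s)) ?G \<in> vmat (k * p + k * p) (k * p + k * p)"
    by (auto simp: bright_def vmat_def distrib_left)
  show "blk (k * p) (k * p) a (\<lambda>i j. s *\<^sub>R (a i j - c i j)) c \<in> vmat (k * p + k * p) (k * p + k * p)"
    by (rule blk_vmat)
  \<comment> \<open>The left factor subtracts \<open>s\<close> times the lower block row from the
    upper one.\<close>
  have G: "?G r q = ?F r q + (if r < k * p then (- s) *\<^sub>R ?F (r + k * p) q else 0)"
    if "r < k * p + k * p" "q < k * p + k * p" for r q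
  proof -
    have "k * (r div k + p) + r mod k = r + k * p"
      by (metis add.assoc add.commute distrib_left mult_div_mod_eq)
    moreover have "r div k < p + p"
      using that div_less_iff[OF k, of r "p + p"] by (simp add: distrib_left)
    ultimately show ?thesis
      using that div_less_iff[OF k, of r p] p
        shear_row_sum[of p "r div k" "\<lambda>x l. cscale J x (?F (k * l + r mod k) q)" "- of_real s"]
      by (simp add: bleft_def distrib_left cscale_of_real flip: of_real_minus)
  qed
  fix r q assume rq: "r < k * p + k * p" "q < k * p + k * p"
  have "k * (q div k - p) + q mod k = q - k * p" if "k * p \<le> q"
  proof -
    have "p \<le> q div k"
      using that div_less_iff[OF k, of q p] by linarith
    then have "k * p \<le> k * (q div k)"
      by simp
    then show ?thesis
      using mult_div_mod_eq[of k q] unfolding diff_mult_distrib2 by linarith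
  qed
  moreover have "q div k < p + p" "p \<le> q div k \<longleftrightarrow> k * p \<le> q"
    using rq div_less_iff[OF k, of q "p + p"] div_less_iff[OF k, of q p] by (auto simp: distrib_left)
  \<comment> \<open>The right factor adds \<open>s\<close> times the left block column to the right
    one.\<close>
  ultimately have "bright J k (p + p) (shear p (of_real s)) ?G r q =
      ?G r q + (if k * p \<le> q then s *\<^sub>R ?G r (q - k * p) else 0)"
    using rq p shear_col_sum[of p "q div k" "\<lambda>x l. cscale J x (?G r (k * l + q mod k))" "of_real s"]
    by (simp add: bright_def distrib_left cscale_of_real)
  also have "\<dots> = (?F r q + (if r < k * p then (- s) *\<^sub>R ?F (r + k * p) q else 0))
      + (if k * p \<le> q then s *\<^sub>R (?F r (q - k * p)
          + (if r < k * p then (- s) *\<^sub>R ?F (r + k * p) (q - k * p) else 0)) else 0)"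
    using rq by (simp only: G less_imp_diff_less)
  also have "\<dots> = blk (k * p) (k * p) a (\<lambda>i j. s *\<^sub>R (a i j - c i j)) c r q"
    using rq by (auto simp: dsum_def blk_def algebra_simps)
  finally show "bright J k (p + p) (shear p (of_real s)) ?G r q
      = blk (k * p) (k * p) a (\<lambda>i j. s *\<^sub>R (a i j - c i j)) c r q" .
qed

text \<open>The sheared direct sum of \<open>Z\<close> and \<open>W\<close> is again a complex
  matrix, so \<open>f\<close> is defined there for every \<open>s\<close>. Its value is the sheared
  direct sum of \<open>f p Z\<close> and \<open>f p W\<close>, and it lies in
  \<open>D\<close>.\<close>

lemma nc_fun_delta_t_eq_0:
  assumes J: "complex_structure J" and f: "nc_fun J D k f" and k: "1 \<le> k" and p: "1 \<le> p"
    and Z: "Z \<in> vmat p p" and W: "W \<in> vmat p p"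
  shows "delta_t D (k * p) (f p Z) (f p W) = 0"
  unfolding delta_t_def delta_eq_0_iff
proof (intro allI impI)
  fix s :: real
  let ?S = "shear p (- of_real s)" and ?T = "shear p (of_real s)"
  let ?X = "cmul (p + p) ?S (cmul (p + p) (dsum p p Z W) ?T)"
  have "f (p + p) ?X = bright J k (p + p) ?T (bleft J k (p + p) ?S (f (p + p) (dsum p p Z W)))"
    using f p cmul_shear_inverse[of p "of_real s"] cmul_shear_inverse[of p "- of_real s"]
    by (auto simp: nc_fun_def shear_vmat dsum_vmat)
  also have "f (p + p) (dsum p p Z W) = dsum (k * p) (k * p) (f p Z) (f p W)"
    using f p Z W by (auto simp: nc_fun_def)
  also have "bright J k (p + p) ?T (bleft J k (p + p) ?S (dsum (k * p) (k * p) (f p Z) (f p W))) =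
      blk (k * p) (k * p) (f p Z) (\<lambda>i j. s *\<^sub>R (f p Z i j - f p W i j)) (f p W)"
    using k p by (intro shear_dsum J) auto
  finally have "f (p + p) ?X = blk (k * p) (k * p) (f p Z) (\<lambda>i j. s *\<^sub>R (f p Z i j - f p W i j)) (f p W)" .
  moreover have "f (p + p) ?X \<in> D (k * (p + p))"
    using f p cmul_vmat[of "p + p" ?S] unfolding nc_fun_def by auto
  ultimately show "blk (k * p) (k * p) (f p Z) (\<lambda>i j. s *\<^sub>R (f p Z i j - f p W i j)) (f p W) \<in> D (k * p + k * p)"
    by (simp add: distrib_left)
qed

section \<open>Pencils at matrices of size 2 and the equivalences\<close>

text \<open>The second row of the scalar matrix is zero, so the lower diagonal block is
  \<open>A\<close> alone. The choice \<open>x = 0\<close> serves (ii), and \<open>x = 1\<close>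
  serves (iii).\<close>

lemma pencil_2:
  assumes J: "complex_structure J" and "A \<in> vmat k k" "B \<in> vmat k k"
  shows "pencil J k A B 2 (\<lambda>i j. if i = 0 then (if j = 0 then of_real x else of_real s) else 0) =
    blk k k (\<lambda>i j. A i j + x *\<^sub>R B i j) (\<lambda>i j. s *\<^sub>R B i j) A"
proof (rule vmat_eqI)
  show "pencil J k A B 2 (\<lambda>i j. if i = 0 then (if j = 0 then of_real x else of_real s) else 0) \<in> vmat (k + k) (k + k)"
    using pencil_vmat[of J k A B 2] by (simp add: mult_2_right)
  show "blk k k (\<lambda>i j. A i j + x *\<^sub>R B i j) (\<lambda>i j. s *\<^sub>R B i j) A \<in> vmat (k + k) (k + k)"
    by (rule blk_vmat)
  fix r q assume rq: "r < k + k" "q < k + k"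
  have dm: "t div k = (if t < k then 0 else 1)" "t mod k = (if t < k then t else t - k)" if "t < k + k" for t
    using that by (auto simp: div_nat_eqI mod_if)
  show "pencil J k A B 2 (\<lambda>i j. if i = 0 then (if j = 0 then of_real x else of_real s) else 0) r q =
    blk k k (\<lambda>i j. A i j + x *\<^sub>R B i j) (\<lambda>i j. s *\<^sub>R B i j) A r q"
    using rq by (simp add: pencil_def dm blk_def cscale_of_real)
qed

lemma blk_off_diagonal_eq_0:
  assumes "b \<in> vmat n m" "blk n m (\<lambda>_ _. 0) b (\<lambda>_ _. 0) = (\<lambda>_ _. 0)"
  shows "b = (\<lambda>_ _. 0)"
proof (rule vmat_eqI[OF assms(1)])
  show "(\<lambda>_ _. 0) \<in> vmat n m" by (simp add: vmat_def)
  fix i j assume "i < n" "j < m"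
  then show "b i j = 0"
    using fun_cong[OF fun_cong[OF assms(2)], of i "n + j"] by (simp add: blk_def)
qed

theorem theorem3p5:
  fixes D :: "nat \<Rightarrow> (nat \<Rightarrow> nat \<Rightarrow> 'a::real_vector) set" and J :: "'a \<Rightarrow> 'a"
  assumes J: "complex_structure J"
    and ncD: "nc_set D"
    and P2: "\<forall>n\<ge>1. \<forall>a\<in>D n. \<forall>U. unitary_mat n U \<longrightarrow> bright J 1 n (adj n U) (bleft J 1 n U a) \<in> D n"
    and P3: "\<forall>n m a c. 1 \<le> n \<longrightarrow> 1 \<le> m \<longrightarrow> a \<in> vmat n n \<longrightarrow> c \<in> vmat m m \<longrightarrow>
               dsum n m a c \<in> D (n + m) \<longrightarrow> a \<in> D n \<and> c \<in> D m"
  shows "((\<forall>n m a c b. 1 \<le> n \<longrightarrow> 1 \<le> m \<longrightarrow> a \<in> D n \<longrightarrow> c \<in> D m \<longrightarrow> b \<in> vmat n m \<longrightarrow>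
             delta D n m a c b = 0 \<longrightarrow> b = (\<lambda>_ _. 0))
       \<longleftrightarrow> (\<forall>n a b. 1 \<le> n \<longrightarrow> a \<in> D n \<longrightarrow> b \<in> vmat n n \<longrightarrow>
             delta D n n a a b = 0 \<longrightarrow> b = (\<lambda>_ _. 0)))
     \<and> ((\<forall>n a b. 1 \<le> n \<longrightarrow> a \<in> D n \<longrightarrow> b \<in> vmat n n \<longrightarrow>
             delta D n n a a b = 0 \<longrightarrow> b = (\<lambda>_ _. 0))
       \<longleftrightarrow> (\<forall>n a c. 1 \<le> n \<longrightarrow> a \<in> D n \<longrightarrow> c \<in> D n \<longrightarrow> delta_t D n a c = 0 \<longrightarrow> a = c))
     \<and> ((\<forall>n a c. 1 \<le> n \<longrightarrow> a \<in> D n \<longrightarrow> c \<in> D n \<longrightarrow> delta_t D n a c = 0 \<longrightarrow> a = c)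
       \<longleftrightarrow> (\<forall>k\<ge>1. \<not> (\<exists>f. nc_fun J D k f \<and> \<not> nc_constant f)))"
proof -
  let ?i = "\<forall>n m a c b. 1 \<le> n \<longrightarrow> 1 \<le> m \<longrightarrow> a \<in> D n \<longrightarrow> c \<in> D m \<longrightarrow> b \<in> vmat n m \<longrightarrow>
             delta D n m a c b = 0 \<longrightarrow> b = (\<lambda>_ _. 0)"
  let ?ii = "\<forall>n a b. 1 \<le> n \<longrightarrow> a \<in> D n \<longrightarrow> b \<in> vmat n n \<longrightarrow>
             delta D n n a a b = 0 \<longrightarrow> b = (\<lambda>_ _. 0)"
  let ?iii = "\<forall>n a c. 1 \<le> n \<longrightarrow> a \<in> D n \<longrightarrow> c \<in> D n \<longrightarrow> delta_t D n a c = 0 \<longrightarrow> a = c"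
  let ?iv = "\<forall>k\<ge>1. \<not> (\<exists>f. nc_fun J D k f \<and> \<not> nc_constant f)"
  \<comment> \<open>Each of (ii), (iii), (iv) yields (i) through the same pencil; only the
    evaluation that forces \<open>B\<close> to vanish differs.\<close>
  have main: "b = (\<lambda>_ _. 0)"
    if h: "?ii \<or> ?iii \<or> ?iv" and n: "1 \<le> n" and m: "1 \<le> m" and a: "a \<in> D n" and c: "c \<in> D m"
      and b: "b \<in> vmat n m" and d: "delta D n m a c b = 0" for n m a c b
  proof -
    define k where "k = n + m"
    define A where "A = dsum n m a c"
    define B where "B = blk n m (\<lambda>_ _. 0) b (\<lambda>_ _. 0)"
    have k: "1 \<le> k" using n by (simp add: k_def)
    have A: "A \<in> vmat k k" and B: "B \<in> vmat k k"
      by (simp_all add: A_def B_def k_def dsum_vmat blk_vmat)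
    have AD: "A \<in> D k"
      using ncD n m a c by (auto simp: nc_set_def A_def k_def)
    have mem: "pencil J k A B p Z \<in> D (k * p)" if "1 \<le> p" for p Z
      using pencil_mem[OF J ncD P2 n m that, of a b c Z] d
      by (simp add: delta_eq_0_iff k_def A_def B_def)
    have mem2: "blk k k (\<lambda>i j. A i j + x *\<^sub>R B i j) (\<lambda>i j. s *\<^sub>R B i j) A \<in> D (k + k)" for x s
      using mem[of 2 "\<lambda>i j. if i = 0 then (if j = 0 then of_real x else of_real s) else 0"]
      by (simp only: pencil_2[OF J A B] mult_2_right one_le_numeral)
    have "B = (\<lambda>_ _. 0)"
      using h
    proof (elim disjE)
      assume ?ii
      moreover have "delta D k k A A B = 0"
        using mem2[of 0] by (simp add: delta_eq_0_iff)
      ultimately show ?thesis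
        using k AD B by blast
    next
      assume iii: ?iii
      \<comment> \<open>Parameter \<open>s = 1\<close> shows that \<open>A + B\<close> is itself a
        point of \<open>D\<close>, so it can be compared with \<open>A\<close>.\<close>
      have "blk n m a b c \<in> D k"
        using d by (auto simp: delta_eq_0_iff k_def dest!: spec[of _ 1])
      also have "blk n m a b c = (\<lambda>i j. A i j + B i j)"
        by (auto simp: A_def B_def dsum_def blk_def fun_eq_iff)
      finally have "(\<lambda>i j. A i j + B i j) \<in> D k" .
      moreover have "delta_t D k (\<lambda>i j. A i j + B i j) A = 0"
        using mem2[of 1] by (simp add: delta_t_def delta_eq_0_iff)
      ultimately have "(\<lambda>i j. A i j + B i j) = A"
        using iii k AD by blast
      then show ?thesis
        by (simp add: fun_eq_iff)
    next
      assume iv: ?iv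
      have "nc_fun J D k (pencil J k A B)"
        using k by (auto simp: nc_fun_def mem pencil_dsum pencil_similarity[OF J])
      then have "nc_constant (pencil J k A B)"
        using iv k by blast
      moreover have "idm 1 \<in> vmat 1 1" "(\<lambda>_ _. 0) \<in> vmat 1 (1::nat)"
        by (auto simp: idm_def vmat_def)
      \<comment> \<open>At size 1 the pencil takes the values \<open>A + B\<close> at 1 and
        \<open>A\<close> at 0, so constancy makes \<open>B\<close> vanish.\<close>
      ultimately have eq: "pencil J k A B 1 (idm 1) = pencil J k A B 1 (\<lambda>_ _. 0)"
        unfolding nc_constant_def by blast
      show ?thesis
      proof (rule vmat_eqI[OF B])
        show "(\<lambda>_ _. 0) \<in> vmat k k" by (simp add: vmat_def)
        fix r s assume "r < k" "s < k"
        then show "B r s = 0"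
          using fun_cong[OF fun_cong[OF eq], of r s] by (simp add: pencil_def idm_def)
      qed
    qed
    then show ?thesis
      using blk_off_diagonal_eq_0[OF b] by (simp add: B_def)
  qed
  have i_ii: "?ii" if ?i
    using that by blast
  have i_iii: "?iii" if ?i
  proof (intro allI impI)
    fix n a c assume n: "1 \<le> n" and ac: "a \<in> D n" "c \<in> D n" and d: "delta_t D n a c = 0"
    have "a \<in> vmat n n" "c \<in> vmat n n"
      using ncD n ac unfolding nc_set_def by blast+
    then have "(\<lambda>i j. a i j - c i j) \<in> vmat n n"
      by (simp add: vmat_def)
    then have "(\<lambda>i j. a i j - c i j) = (\<lambda>_ _. 0)"
      using that n ac d unfolding delta_t_def by blast
    then show "a = c"
      by (simp add: fun_eq_iff)
  qed
  have iii_iv: "?iv" if ?iii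
  proof (intro allI impI notI)
    fix k :: nat assume k: "1 \<le> k" and "\<exists>f. nc_fun J D k f \<and> \<not> nc_constant f"
    then obtain f where f: "nc_fun J D k f" and "\<not> nc_constant f" by blast
    \<comment> \<open>Constancy is meant level by level, so its failure provides two matrices of the
      same size.\<close>
    then obtain p Z W where p: "1 \<le> p" and ZW: "Z \<in> vmat p p" "W \<in> vmat p p" and ne: "f p Z \<noteq> f p W"
      by (auto simp: nc_constant_def)
    have "f p Z \<in> D (k * p)" "f p W \<in> D (k * p)"
      using f p ZW by (auto simp: nc_fun_def)
    moreover have "1 \<le> k * p" using k p by simp
    ultimately show False
      using that ne nc_fun_delta_t_eq_0[OF J f k p ZW] by blast
  qed
  have "?i" if "?ii \<or> ?iii \<or> ?iv"
    using main[OF that] by (intro allI impI)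
  then show ?thesis
    using i_ii i_iii iii_iv by argo
qed

end
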